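(* Let $n\ge3$ and $\tau>0$. Let $q\in\Delta(\mathcal U_r)$ satisfy the Held--Karp equilibrium (degree-balance) condition $\mathbb E_q[d_i(U)]=2$ for all $i\in\bar V$. Then the non-tour mass $\gamma(q)=q(\mathcal U_r\setminus\mathcal H)$ satisfies $$\gamma(q)\le\frac12\sum_{i\in\bar V}\operatorname{Var}_q(d_i(U)).$$ For the equilibrated Gibbs law $q^\star=q_{c+A\lambda^\star(c)}$, where $c\in\mathbb R^{|\mathcal E|}$ and $\lambda^\star(c)$ satisfies $\nabla_\lambda\Phi_\tau(c,\lambda^\star(c))=0$, this becomes $$\gamma(q^\star)\le\frac12\sum_{i\in\bar V}\operatorname{Var}_{q^\star}(d_i(U))=\frac12\operatorname{tr}\operatorname{Cov}_{q^\star}(d(U),d(U))=-\frac\tau2\operatorname{tr}\nabla^2_{\lambda\lambda}\Phi_\tau(c,\lambda^\star(c)),$$ where $d(U)=(d_i(U))_{i\in\bar V}$.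
   Context: Let $V=\{1,\dots,n\}$, $n\ge3$, and let $\mathcal E$ be the edge set of the complete undirected graph on $V$. Fix a root $r\in V$ and set $\bar V:=V\setminus\{r\}$. A rooted $1$-tree is an edge set $U\subseteq\mathcal E$ consisting of the edges of a spanning tree of the complete graph on $\bar V$ together with exactly two distinct edges incident to $r$. $\mathcal U_r$ is the set of all rooted $1$-trees and $\Delta(\mathcal U_r)$ the set of probability distributions on $\mathcal U_r$. $\mathcal H\subseteq\mathcal U_r$ is the set of (edge sets of) Hamiltonian cycles on $V$. For $U\in\mathcal U_r$, $x_U\in\{0,1\}^{|\mathcal E|}$ is its edge-incidence vector and $d_i(U)$ the degree of node $i$ in $U$. With temperature $\tau>0$ and $\eta\in\mathbb R^{|\mathcal E|}$, the Gibbs law is $q_\eta(U)=\frac{1}{Z_r(\eta)}\exp(-\frac1\tau\langle\eta,x_U\rangle)$, $U\in\mathcal U_r$, with $Z_r(\eta)=\sum_{U\in\mathcal U_r}\exp(-\frac1\tau\langle\eta,x_U\rangle)$. Vectors $\lambda\in\mathbb R^{n-1}$ are indexed by $\bar V$; $A:\mathbb R^{n-1}\to\mathbb R^{|\mathcal E|}$ is the linear map $(A\lambda)_{ij}=\lambda_i+\lambda_j$ for $i,j\in\bar V$ and $(A\lambda)_{rk}=\lambda_k$ for $k\in\bar V$. The dual objective is $\Phi_\tau(c,\lambda):=-\tau\log Z_r(c+A\lambda)-2\,\mathbf 1^\top\lambda$. *)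

theory Defs
  imports "HOL-Analysis.Analysis" "HOL-Probability.Probability"
begin

section \<open>Rooted 1-trees and Hamiltonian cycles\<close>

text \<open>The vertex set is \<open>{1..n}\<close>. An undirected edge is a two-element vertex set, and a graph
  on a given vertex set is identified with its set of edges.\<close>

definition complete_edges :: "'v set \<Rightarrow> 'v set set" where
  "complete_edges W = {e. e \<subseteq> W \<and> card e = 2}"

text \<open>A (simple) cycle is given by the list of its vertices in cyclic order.\<close>

definition cycle_list :: "'v list \<Rightarrow> bool" where
  "cycle_list xs \<longleftrightarrow> 3 \<le> length xs \<and> distinct xs"

definition cycle_edges :: "'v list \<Rightarrow> 'v set set" where
  "cycle_edges xs = {{xs ! i, xs ! (Suc i mod length xs)} | i. i < length xs}"

definition edges_connected :: "'v set \<Rightarrow> 'v set set \<Rightarrow> bool" where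
  "edges_connected W T \<longleftrightarrow> (\<forall>u\<in>W. \<forall>v\<in>W. (u, v) \<in> {(x, y). {x, y} \<in> T}\<^sup>*)"

definition edges_acyclic :: "'v set set \<Rightarrow> bool" where
  "edges_acyclic T \<longleftrightarrow> \<not> (\<exists>xs. cycle_list xs \<and> cycle_edges xs \<subseteq> T)"

definition is_spanning_tree :: "'v set \<Rightarrow> 'v set set \<Rightarrow> bool" where
  "is_spanning_tree W T \<longleftrightarrow>
     T \<subseteq> complete_edges W \<and> edges_connected W T \<and> edges_acyclic T"

definition one_trees :: "nat \<Rightarrow> nat \<Rightarrow> nat set set set" where
  "one_trees n r = {T \<union> {e, f} | T e f.
     is_spanning_tree ({1..n} - {r}) T \<and>
     e \<in> complete_edges {1..n} \<and> f \<in> complete_edges {1..n} \<and> r \<in> e \<and> r \<in> f \<and> e \<noteq> f}"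

definition ham_cycles :: "nat \<Rightarrow> nat set set set" where
  "ham_cycles n = {cycle_edges xs | xs. cycle_list xs \<and> set xs = {1..n}}"

definition vertex_degree :: "'v \<Rightarrow> 'v set set \<Rightarrow> nat" where
  "vertex_degree i U = card {e \<in> U. i \<in> e}"

definition incidence :: "'v set set \<Rightarrow> 'v set \<Rightarrow> real" where
  "incidence U e = (if e \<in> U then 1 else 0)"

section \<open>Probability\<close>

text \<open>\<open>\<Delta>(\<U>\<^sub>r)\<close>: distributions on edge sets that are supported on the 1-trees.\<close>

definition one_tree_dists :: "nat \<Rightarrow> nat \<Rightarrow> nat set set pmf set" where
  "one_tree_dists n r = {q. set_pmf q \<subseteq> one_trees n r}"

definition non_tour_mass :: "nat \<Rightarrow> nat \<Rightarrow> nat set set pmf \<Rightarrow> real" where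
  "non_tour_mass n r q = measure_pmf.prob q (one_trees n r - ham_cycles n)"

definition covariance :: "'a pmf \<Rightarrow> ('a \<Rightarrow> real) \<Rightarrow> ('a \<Rightarrow> real) \<Rightarrow> real" where
  "covariance q X Y = measure_pmf.expectation q
     (\<lambda>\<omega>. (X \<omega> - measure_pmf.expectation q X) * (Y \<omega> - measure_pmf.expectation q Y))"

definition covariance_matrix :: "'a pmf \<Rightarrow> ('a \<Rightarrow> real ^ 'k) \<Rightarrow> real ^ 'k ^ 'k" where
  "covariance_matrix q X = (\<chi> i j. covariance q (\<lambda>\<omega>. X \<omega> $ i) (\<lambda>\<omega>. X \<omega> $ j))"

text \<open>Edge vectors \<open>\<eta>\<close> are functions on vertex sets; only their values on
  the edges of the complete graph are ever used.\<close>

definition edge_inner :: "nat \<Rightarrow> (nat set \<Rightarrow> real) \<Rightarrow> (nat set \<Rightarrow> real) \<Rightarrow> real" where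
  "edge_inner n \<eta> x = (\<Sum>e\<in>complete_edges {1..n}. \<eta> e * x e)"

definition partition_fun :: "nat \<Rightarrow> nat \<Rightarrow> real \<Rightarrow> (nat set \<Rightarrow> real) \<Rightarrow> real" where
  "partition_fun n r \<tau> \<eta> = (\<Sum>U\<in>one_trees n r. exp (- (1 / \<tau>) * edge_inner n \<eta> (incidence U)))"

text \<open>The function given to \<open>embed_pmf\<close> is a probability mass function
  whenever \<open>n \<ge> 3\<close> and \<open>r \<in> {1..n}\<close>; see \<open>pmf_gibbs\<close> below.\<close>

definition gibbs :: "nat \<Rightarrow> nat \<Rightarrow> real \<Rightarrow> (nat set \<Rightarrow> real) \<Rightarrow> nat set set pmf" where
  "gibbs n r \<tau> \<eta> = embed_pmf (\<lambda>U. if U \<in> one_trees n r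
     then exp (- (1 / \<tau>) * edge_inner n \<eta> (incidence U)) / partition_fun n r \<tau> \<eta> else 0)"

section \<open>The dual objective\<close>

text \<open>Vectors \<open>\<lambda> \<in> \<real>\<^sup>n\<^sup>-\<^sup>1\<close> indexed by the non-root vertices are elements of \<open>real ^ 'k\<close>, where
  \<open>\<nu>\<close> is a bijection from the finite index type \<open>'k\<close> onto \<open>{1..n} - {r}\<close>: the entry of
  \<open>\<lambda>\<close> at the vertex \<open>\<nu> k\<close> is \<open>\<lambda> $ k\<close>.\<close>

definition indexes_nonroot :: "nat \<Rightarrow> nat \<Rightarrow> ('k::finite \<Rightarrow> nat) \<Rightarrow> bool" where
  "indexes_nonroot n r \<nu> \<longleftrightarrow> bij_betw \<nu> UNIV ({1..n} - {r})"

text \<open>\<open>(A \<lambda>)\<^sub>e\<close> is the sum of the entries of \<open>\<lambda>\<close> at the non-root endpoints of \<open>e\<close>; the two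
  lemmas after the definition give the usual description.\<close>

definition lift_potential :: "('k::finite \<Rightarrow> nat) \<Rightarrow> real ^ 'k \<Rightarrow> nat set \<Rightarrow> real" where
  "lift_potential \<nu> lam e = (\<Sum>k | \<nu> k \<in> e. lam $ k)"

lemma lift_potential_nonroot:
  assumes "indexes_nonroot n r \<nu>" and "i \<noteq> j"
  shows "lift_potential \<nu> lam {\<nu> i, \<nu> j} = lam $ i + lam $ j"
proof -
  from assms(1) have "inj \<nu>" by (auto simp: indexes_nonroot_def bij_betw_def)
  hence "{k. \<nu> k \<in> {\<nu> i, \<nu> j}} = {i, j}" by (auto dest: injD)
  with assms(2) show ?thesis by (simp add: lift_potential_def)
qed

lemma lift_potential_root:
  assumes "indexes_nonroot n r \<nu>"
  shows "lift_potential \<nu> lam {r, \<nu> k} = lam $ k"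
proof -
  from assms have "inj \<nu>" and "\<And>l. \<nu> l \<noteq> r"
    by (auto simp: indexes_nonroot_def bij_betw_def)
  hence "{l. \<nu> l \<in> {r, \<nu> k}} = {k}" by (auto dest: injD)
  thus ?thesis by (simp add: lift_potential_def)
qed

definition shifted_cost ::
    "('k::finite \<Rightarrow> nat) \<Rightarrow> (nat set \<Rightarrow> real) \<Rightarrow> real ^ 'k \<Rightarrow> nat set \<Rightarrow> real" where
  "shifted_cost \<nu> c lam e = c e + lift_potential \<nu> lam e"

definition dual_objective ::
    "nat \<Rightarrow> nat \<Rightarrow> ('k::finite \<Rightarrow> nat) \<Rightarrow> real \<Rightarrow> (nat set \<Rightarrow> real) \<Rightarrow> real ^ 'k \<Rightarrow> real" where
  "dual_objective n r \<nu> \<tau> c lam =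
     - \<tau> * ln (partition_fun n r \<tau> (shifted_cost \<nu> c lam)) - 2 * (1 \<bullet> lam)"

definition degree_vector :: "('k::finite \<Rightarrow> nat) \<Rightarrow> nat set set \<Rightarrow> real ^ 'k" where
  "degree_vector \<nu> U = (\<chi> k. real (vertex_degree (\<nu> k) U))"

definition gradient :: "('a::real_inner \<Rightarrow> real) \<Rightarrow> 'a \<Rightarrow> 'a" where
  "gradient f x = (THE D. GDERIV f x :> D)"

text \<open>The Hessian is the Jacobian matrix of the gradient.\<close>

definition hessian :: "(real ^ 'k \<Rightarrow> real) \<Rightarrow> real ^ 'k \<Rightarrow> real ^ 'k ^ 'k" where
  "hessian f x = matrix (frechet_derivative (gradient f) (at x))"

section \<open>The Gibbs law is well defined\<close>

lemma finite_one_trees: "finite (one_trees n r)"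
proof (rule finite_subset)
  show "one_trees n r \<subseteq> Pow (complete_edges {1..n})"
    by (fastforce simp: one_trees_def is_spanning_tree_def complete_edges_def)
  have "complete_edges {1..n} \<subseteq> Pow {1..n}" by (auto simp: complete_edges_def)
  thus "finite (Pow (complete_edges {1..n}))"
    by (meson finite_Pow_iff finite_atLeastAtMost finite_subset)
qed

lemma is_spanning_tree_star:
  assumes "w \<in> W"
  shows "is_spanning_tree W {{w, v} | v. v \<in> W - {w}}" (is "is_spanning_tree W ?T")
  unfolding is_spanning_tree_def
proof (intro conjI)
  show "?T \<subseteq> complete_edges W"
    using assms by (auto simp: complete_edges_def card_2_iff)
  let ?R = "{(x, y). {x, y} \<in> ?T}"
  have "(w, v) \<in> ?R\<^sup>*" "(v, w) \<in> ?R\<^sup>*" if "v \<in> W" for v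
  proof -
    have "v = w \<or> ((w, v) \<in> ?R \<and> (v, w) \<in> ?R)"
      using that by (auto simp: insert_commute)
    thus "(w, v) \<in> ?R\<^sup>*" "(v, w) \<in> ?R\<^sup>*" by auto
  qed
  thus "edges_connected W ?T"
    unfolding edges_connected_def by (meson rtrancl_trans)
  show "edges_acyclic ?T"
    unfolding edges_acyclic_def
  proof clarify
    fix xs assume xs: "cycle_list xs" "cycle_edges xs \<subseteq> ?T"
    define m where "m = length xs"
    have m: "3 \<le> m" "distinct xs" using xs by (auto simp: cycle_list_def m_def)
    have w: "w = xs ! i \<or> w = xs ! (Suc i mod m)" if "i < m" for i
    proof -
      have "{xs ! i, xs ! (Suc i mod m)} \<in> ?T"
        using xs(2) that by (auto simp: cycle_edges_def m_def)
      thus ?thesis by (auto simp: doubleton_eq_iff)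
    qed
    have inj: "xs ! i = xs ! j \<longleftrightarrow> i = j" if "i < m" "j < m" for i j
      using m that by (auto simp: nth_eq_iff_index_eq m_def)
    have "w = xs ! 0 \<or> w = xs ! 1" "w = xs ! 1 \<or> w = xs ! 2"
      using w[of 0] w[of 1] m by (auto simp: numeral_2_eq_2)
    hence "w = xs ! 1" using inj[of 0 2] inj[of 0 1] m by auto
    moreover have "w = xs ! 2 \<or> w = xs ! (3 mod m)"
      using w[of 2] m by (simp add: numeral_3_eq_3 numeral_2_eq_2)
    moreover have "3 mod m < m" "3 mod m \<noteq> 1"
      using m by (cases "m = 3"; simp)+
    ultimately show False
      using inj[of 1 2] inj[of 1 "3 mod m"] m by auto
  qed
qed

lemma one_trees_nonempty:
  assumes "3 \<le> n" "r \<in> {1..n}"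
  shows "one_trees n r \<noteq> {}"
proof -
  have "card ({1..n} - {r}) \<ge> 2" using assms by simp
  then obtain u v where uv: "u \<in> {1..n} - {r}" "v \<in> {1..n} - {r}" "u \<noteq> v"
    by (metis card_le_Suc0_iff_eq finite_Diff finite_atLeastAtMost not_less_eq_eq numeral_2_eq_2)
  have "{{u, x} | x. x \<in> {1..n} - {r} - {u}} \<union> {{r, u}, {r, v}} \<in> one_trees n r"
    unfolding one_trees_def mem_Collect_eq
    by (intro exI conjI, rule refl, rule is_spanning_tree_star)
       (use uv assms in \<open>auto simp: complete_edges_def doubleton_eq_iff\<close>)
  thus ?thesis by blast
qed

lemma pmf_gibbs:
  assumes "3 \<le> n" "r \<in> {1..n}"
  shows "pmf (gibbs n r \<tau> \<eta>) U = (if U \<in> one_trees n r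
     then exp (- (1 / \<tau>) * edge_inner n \<eta> (incidence U)) / partition_fun n r \<tau> \<eta> else 0)"
proof -
  let ?w = "\<lambda>U. exp (- (1 / \<tau>) * edge_inner n \<eta> (incidence U))"
  let ?Z = "partition_fun n r \<tau> \<eta>"
  let ?f = "\<lambda>U. if U \<in> one_trees n r then ?w U / ?Z else 0"
  have Z: "?Z > 0" unfolding partition_fun_def
    using assms by (intro sum_pos) (auto simp: finite_one_trees one_trees_nonempty)
  have "(\<integral>\<^sup>+U. ennreal (?f U) \<partial>count_space UNIV) = (\<Sum>U\<in>one_trees n r. ennreal (?f U))"
    by (rule nn_integral_count_space') (auto simp: finite_one_trees)
  also have "\<dots> = ennreal (\<Sum>U\<in>one_trees n r. ?w U / ?Z)"
    using Z by (subst sum_ennreal) (auto intro!: sum.cong)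
  also have "(\<Sum>U\<in>one_trees n r. ?w U / ?Z) = 1"
    using Z by (simp add: sum_divide_distrib[symmetric] partition_fun_def)
  finally have one: "(\<integral>\<^sup>+U. ennreal (?f U) \<partial>count_space UNIV) = 1" by simp
  show ?thesis unfolding gibbs_def
    by (rule pmf_embed_pmf) (use Z one in auto)
qed

end

theory Submission
  imports Defs
begin

text \<open>A 1-tree is connected and has degree 2 at the root, so it is a tour as soon as all its other
  degrees are 2 as well. By the handshake lemma the deviations \<open>d\<^sub>i - 2\<close> have an even sum, and so do
  their squares; hence \<open>(\<Sum>i. (d\<^sub>i - 2)\<^sup>2) / 2\<close> dominates the indicator of the non-tours, and its
  expectation is half the total variance under degree balance. For the Gibbs law, \<open>\<nabla>\<Phi> = E d - 2\<close>, so a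
  critical point is exactly a degree-balanced law, and \<open>\<nabla>\<^sup>2\<Phi> = - Cov(d, d) / \<tau>\<close> as for every
  exponential family.\<close>

section \<open>Degrees and cycles\<close>

lemma complete_edges_otherE:
  assumes "e \<in> complete_edges W" "x \<in> e"
  obtains y where "e = {x, y}" "y \<in> W" "y \<noteq> x"
  using assms by (auto simp: complete_edges_def card_2_iff doubleton_eq_iff)

lemma finite_complete_edges: "finite W \<Longrightarrow> finite (complete_edges W)"
  by (rule finite_subset[of _ "Pow W"]) (auto simp: complete_edges_def)

lemma sum_vertex_degree:
  assumes "finite W" "U \<subseteq> complete_edges W"
  shows "(\<Sum>i\<in>W. vertex_degree i U) = 2 * card U"
  unfolding vertex_degree_def
proof (rule sum_multicount[OF assms(1)])
  show "finite U" using assms finite_complete_edges finite_subset by blast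
  show "\<forall>e\<in>U. card {i \<in> W. i \<in> e} = 2"
  proof
    fix e assume "e \<in> U"
    then have "{i \<in> W. i \<in> e} = e" "card e = 2" using assms(2) by (auto simp: complete_edges_def)
    then show "card {i \<in> W. i \<in> e} = 2" by simp
  qed
qed

text \<open>Longest-path argument: every neighbour of the first vertex of a longest simple path lies
  on that path, and the second edge there closes a prefix of it to a cycle.\<close>

lemma exists_cycle_if_degree_ge_2:
  assumes fin: "finite W" and ne: "W \<noteq> {}" and U: "U \<subseteq> complete_edges W"
    and deg: "\<And>x. x \<in> W \<Longrightarrow> 2 \<le> vertex_degree x U"
  obtains xs where "cycle_list xs" "cycle_edges xs \<subseteq> U" "set xs \<subseteq> W"
proof -
  define P where "P xs \<longleftrightarrow> xs \<noteq> [] \<and> distinct xs \<and> set xs \<subseteq> W \<and> successively (\<lambda>x y. {x, y} \<in> U) xs"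
    for xs
  obtain w where "w \<in> W" using ne by blast
  then have "P [w]" by (simp add: P_def)
  \<comment> \<open>Simple paths repeat no vertex, so their lengths are bounded and a longest one
    exists.\<close>
  moreover have "length xs < Suc (card W)" if "P xs" for xs
    using that card_mono[OF fin, of "set xs"] distinct_card[of xs] by (simp add: P_def)
  ultimately have "\<exists>xs. P xs \<and> (\<forall>ys. P ys \<longrightarrow> length ys \<le> length xs)"
    by (intro ex_has_greatest_nat allI impI)
  then obtain xs where xs: "P xs" and max: "\<And>ys. P ys \<Longrightarrow> length ys \<le> length xs"
    by blast
  define x where "x = xs ! 0"
  have xW: "x \<in> W" using xs by (auto simp: P_def x_def)
  \<comment> \<open>A neighbour of \<open>x\<close> off the path could be prepended, contradicting
    maximality.\<close>
  have nbr: "\<exists>i. 0 < i \<and> i < length xs \<and> e = {x, xs ! i}" if "e \<in> U" "x \<in> e" for e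
  proof -
    have "e \<in> complete_edges W" using that U by blast
    then obtain y where y: "e = {x, y}" "y \<in> W" "y \<noteq> x"
      using \<open>x \<in> e\<close> by (rule complete_edges_otherE)
    have "y \<in> set xs"
    proof (rule ccontr)
      assume "y \<notin> set xs"
      then have "P (y # xs)"
        using xs y that by (cases xs) (auto simp: P_def x_def insert_commute)
      then show False using max[of "y # xs"] by simp
    qed
    then obtain i where "i < length xs" "y = xs ! i" by (metis in_set_conv_nth)
    then show ?thesis using y by (cases i) (auto simp: x_def)
  qed
  have "2 \<le> card {e \<in> U. x \<in> e}" using deg[OF xW] by (simp add: vertex_degree_def)
  then obtain e f where ef: "e \<in> U" "x \<in> e" "f \<in> U" "x \<in> f" "e \<noteq> f"
    by (auto simp: numeral_2_eq_2 card_le_Suc_iff)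
  obtain i j where ij: "0 < i" "i < length xs" "e = {x, xs ! i}" "0 < j" "j < length xs" "f = {x, xs ! j}"
    using nbr ef by meson
  have "i \<noteq> j" using ij ef by auto
  \<comment> \<open>Of two distinct positive positions the larger is at least 2, so the prefix
    ending there has the three vertices that \<open>cycle_list\<close> requires.\<close>
  then have "2 \<le> max i j" "max i j < length xs" "{x, xs ! max i j} \<in> U"
    using ij ef by (auto simp: max_def)
  then obtain j where j: "2 \<le> j" "j < length xs" "{x, xs ! j} \<in> U" by blast
  have path: "{xs ! k, xs ! Suc k} \<in> U" if "Suc k < length xs" for k
    using xs that by (auto simp: P_def successively_conv_nth)
  show thesis
  proof
    show "cycle_list (take (Suc j) xs)" "set (take (Suc j) xs) \<subseteq> W"
      using xs j set_take_subset by (fastforce simp: cycle_list_def P_def)+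
    show "cycle_edges (take (Suc j) xs) \<subseteq> U"
    proof
      fix e assume "e \<in> cycle_edges (take (Suc j) xs)"
      then obtain k where k: "k \<le> j" "e = {xs ! k, take (Suc j) xs ! (Suc k mod Suc j)}"
        using j by (auto simp: cycle_edges_def less_Suc_eq_le)
      show "e \<in> U"
      proof (cases "k = j")
        \<comment> \<open>The closing edge: the successor index wraps around to 0, that is, to
          \<open>x\<close>.\<close>
        case True
        then show ?thesis using k j by (auto simp: x_def insert_commute)
      next
        case False
        then have "Suc k mod Suc j = Suc k" "k < j" using k by auto
        then show ?thesis using k j path[of k] by auto
      qed
    qed
  qed
qed

text \<open>The edges to the cyclic predecessor and successor of \<open>x\<close> differ, because a
  cycle has at least three vertices.\<close>

lemma vertex_degree_cycle_ge_2:
  assumes "cycle_list xs" "x \<in> set xs"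
  shows "2 \<le> vertex_degree x (cycle_edges xs)"
proof -
  define m where "m = length xs"
  have m: "3 \<le> m" "distinct xs" using assms by (auto simp: cycle_list_def m_def)
  obtain i where i: "i < m" "x = xs ! i" using assms(2) by (metis in_set_conv_nth m_def)
  \<comment> \<open>The cyclic predecessor of \<open>i\<close>, with the wrap-around at 0 made
    explicit to avoid truncated subtraction.\<close>
  define p where "p = (if i = 0 then m - 1 else i - 1)"
  have p: "p < m" "Suc p mod m = i" "p \<noteq> i" using i m by (auto simp: p_def)
  have s: "Suc i mod m < m" "Suc i mod m \<noteq> i" "Suc i mod m \<noteq> p"
    using i m by (auto simp: p_def mod_Suc)
  let ?C = "{{xs ! p, x}, {x, xs ! (Suc i mod m)}}"
  have "card ?C = 2"
    using p s i m by (auto simp: doubleton_eq_iff nth_eq_iff_index_eq m_def)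
  moreover have "?C \<subseteq> {e \<in> cycle_edges xs. x \<in> e}"
    using p i by (auto simp: cycle_edges_def m_def)
  moreover have "finite {e \<in> cycle_edges xs. x \<in> e}" by (simp add: cycle_edges_def)
  ultimately show ?thesis
    unfolding vertex_degree_def by (metis card_mono)
qed

text \<open>Any cycle inside \<open>U\<close> already uses up both edges at each of its vertices, so
  no edge of \<open>U\<close> leaves it; by connectedness it covers \<open>W\<close>, and then it
  contains every edge.\<close>

lemma connected_2_regular_is_cycle:
  assumes fin: "finite W" and ne: "W \<noteq> {}" and U: "U \<subseteq> complete_edges W"
    and conn: "edges_connected W U" and deg: "\<And>x. x \<in> W \<Longrightarrow> vertex_degree x U = 2"
  obtains xs where "cycle_list xs" "set xs = W" "cycle_edges xs = U"
proof -
  obtain xs where xs: "cycle_list xs" "cycle_edges xs \<subseteq> U" "set xs \<subseteq> W"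
    using exists_cycle_if_degree_ge_2[OF fin ne U] deg by (metis order_refl)
  have finU: "finite U" using U fin finite_complete_edges finite_subset by blast
  \<comment> \<open>At a vertex of the cycle, degree at least 2 in the cycle and exactly 2 in
    \<open>U\<close> force the incident edge sets to coincide.\<close>
  have inc: "e \<in> cycle_edges xs" if "x \<in> set xs" "e \<in> U" "x \<in> e" for x e
  proof -
    have "{e \<in> cycle_edges xs. x \<in> e} = {e \<in> U. x \<in> e}"
    proof (rule card_seteq)
      show "card {e \<in> U. x \<in> e} \<le> card {e \<in> cycle_edges xs. x \<in> e}"
        using deg[of x] vertex_degree_cycle_ge_2[OF xs(1) that(1)] that xs(3)
        by (auto simp: vertex_degree_def)
    qed (use finU xs in auto)
    then show ?thesis using that by blast
  qed
  have verts: "e \<subseteq> set xs" if "e \<in> cycle_edges xs" for e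
    using that by (auto simp: cycle_edges_def) (metis length_pos_if_in_set mod_less_divisor nth_mem)
  have "xs \<noteq> []" using xs by (auto simp: cycle_list_def)
  then have x0: "hd xs \<in> set xs" by simp
  have "W \<subseteq> set xs"
  proof
    fix v assume "v \<in> W"
    then have "(hd xs, v) \<in> {(x, y). {x, y} \<in> U}\<^sup>*"
      using conn x0 xs by (auto simp: edges_connected_def)
    then show "v \<in> set xs"
      \<comment> \<open>Along a walk that starts on the cycle, \<open>inc\<close> puts each edge
        into the cycle and \<open>verts\<close> puts its other end there.\<close>
      by (induction rule: rtrancl_induct) (use x0 inc verts in auto)
  qed
  moreover have "U \<subseteq> cycle_edges xs"
  proof
    fix e assume e: "e \<in> U"
    then have "e \<subseteq> W" "e \<noteq> {}" using U by (auto simp: complete_edges_def)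
    then show "e \<in> cycle_edges xs" using inc e \<open>W \<subseteq> set xs\<close> by blast
  qed
  ultimately show thesis using that xs by blast
qed

section \<open>Rooted 1-trees\<close>

lemma one_trees_subset_complete_edges: "U \<in> one_trees n r \<Longrightarrow> U \<subseteq> complete_edges {1..n}"
  by (fastforce simp: one_trees_def is_spanning_tree_def complete_edges_def)

lemma vertex_degree_root:
  assumes "U \<in> one_trees n r"
  shows "vertex_degree r U = 2"
proof -
  obtain T e f where U: "U = T \<union> {e, f}" "is_spanning_tree ({1..n} - {r}) T"
    "r \<in> e" "r \<in> f" "e \<noteq> f" using assms by (auto simp: one_trees_def)
  then have "{g \<in> U. r \<in> g} = {e, f}" by (auto simp: is_spanning_tree_def complete_edges_def)
  then show ?thesis using U by (simp add: vertex_degree_def)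
qed

text \<open>One root edge attaches \<open>r\<close> to the connected tree; its other end
  \<open>k\<close> is a hub through which any two vertices are joined.\<close>

lemma one_trees_connected:
  assumes "U \<in> one_trees n r"
  shows "edges_connected {1..n} U"
proof -
  obtain T e where U: "T \<subseteq> U" "e \<in> U" "is_spanning_tree ({1..n} - {r}) T"
    "e \<in> complete_edges {1..n}" "r \<in> e" using assms by (auto simp: one_trees_def)
  obtain k where k: "e = {r, k}" "k \<in> {1..n}" "k \<noteq> r"
    using U complete_edges_otherE by metis
  let ?R = "{(x, y). {x, y} \<in> U}"
  have "(x, y) \<in> {(x, y). {x, y} \<in> T}\<^sup>*" if "x \<in> {1..n} - {r}" "y \<in> {1..n} - {r}" for x y
    using U that by (auto simp: is_spanning_tree_def edges_connected_def)
  moreover have "{(x, y). {x, y} \<in> T}\<^sup>* \<subseteq> ?R\<^sup>*" using U by (intro rtrancl_mono) auto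
  ultimately have T: "(x, y) \<in> ?R\<^sup>*" if "x \<in> {1..n} - {r}" "y \<in> {1..n} - {r}" for x y
    using that by blast
  have "(r, k) \<in> ?R" "(k, r) \<in> ?R" using U k by (auto simp: insert_commute)
  then have "(x, k) \<in> ?R\<^sup>*" "(k, x) \<in> ?R\<^sup>*" if "x \<in> {1..n}" for x
    using T[of x k] T[of k x] that k by (cases "x = r"; auto)+
  then show ?thesis unfolding edges_connected_def by (meson rtrancl_trans)
qed

text \<open>The sum is the real image of an integer that is positive and even. It is positive
  because all degrees equal to 2 would make \<open>U\<close> a tour, and even by the handshake
  lemma.\<close>

lemma degree_deviation_ge_2:
  assumes "r \<in> {1..n}" "U \<in> one_trees n r" "U \<notin> ham_cycles n"
  shows "2 \<le> (\<Sum>i\<in>{1..n} - {r}. (real (vertex_degree i U) - 2)\<^sup>2)"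
proof -
  let ?W = "{1..n} - {r}"
  \<comment> \<open>Integer deviations: subtraction is not truncated, and parity is
    available.\<close>
  let ?d = "\<lambda>i. int (vertex_degree i U) - 2"
  have "\<exists>i\<in>?W. ?d i \<noteq> 0"
  proof (rule ccontr)
    assume "\<not> ?thesis"
    then have "vertex_degree i U = 2" if "i \<in> {1..n}" for i
      using that vertex_degree_root[OF assms(2)] by (cases "i = r") auto
    then obtain xs where "cycle_list xs" "set xs = {1..n}" "cycle_edges xs = U"
      using connected_2_regular_is_cycle[of "{1..n}" U] assms one_trees_connected
        one_trees_subset_complete_edges by (metis empty_iff finite_atLeastAtMost)
    then show False using assms(3) by (auto simp: ham_cycles_def)
  qed
  then have pos: "0 < (\<Sum>i\<in>?W. (?d i)\<^sup>2)"
    by (subst sum_nonneg_eq_0_iff less_le)+ (auto intro!: sum_nonneg simp: sum_nonneg_eq_0_iff)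
  have "vertex_degree r U + (\<Sum>i\<in>?W. vertex_degree i U) = 2 * card U"
    using sum_vertex_degree[OF _ one_trees_subset_complete_edges[OF assms(2)]] assms(1)
    by (simp add: sum.remove)
  \<comment> \<open>The root contributes 2 to an even total.\<close>
  then have "even (\<Sum>i\<in>?W. vertex_degree i U)"
    using vertex_degree_root[OF assms(2)] by (metis dvd_add_right_iff dvd_triv_left dvd_refl)
  \<comment> \<open>Subtracting 2 and squaring preserve the parity of each summand.\<close>
  then have "even (\<Sum>i\<in>?W. (?d i)\<^sup>2)"
    by (simp add: even_sum_iff)
  then have "2 \<le> (\<Sum>i\<in>?W. (?d i)\<^sup>2)" using pos by presburger
  then have "real_of_int 2 \<le> real_of_int (\<Sum>i\<in>?W. (?d i)\<^sup>2)" by (simp only: of_int_le_iff)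
  then show ?thesis by simp
qed

lemma non_tour_mass_le:
  assumes r: "r \<in> {1..n}" and q: "q \<in> one_tree_dists n r"
    and mean: "\<And>i. i \<in> {1..n} - {r} \<Longrightarrow> measure_pmf.expectation q (\<lambda>U. real (vertex_degree i U)) = 2"
  shows "non_tour_mass n r q
    \<le> 1 / 2 * (\<Sum>i\<in>{1..n} - {r}. measure_pmf.variance q (\<lambda>U. real (vertex_degree i U)))"
proof -
  have sub: "set_pmf q \<subseteq> one_trees n r" using q by (simp add: one_tree_dists_def)
  then have "finite (set_pmf q)" using finite_one_trees finite_subset by blast
  \<comment> \<open>On a finite support every function is integrable.\<close>
  note int = integrable_measure_pmf_finite[OF this]
  let ?D = "\<lambda>U. 1 / 2 * (\<Sum>i\<in>{1..n} - {r}. (real (vertex_degree i U) - 2)\<^sup>2)"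
  have "non_tour_mass n r q = measure_pmf.expectation q (indicator (one_trees n r - ham_cycles n))"
    by (simp add: non_tour_mass_def)
  also have "\<dots> \<le> measure_pmf.expectation q ?D"
  proof (rule integral_mono_AE[OF int int])
    \<comment> \<open>Off the non-tours the indicator is 0 and \<open>?D\<close> is
      nonnegative.\<close>
    show "AE U in measure_pmf q. indicator (one_trees n r - ham_cycles n) U \<le> ?D U"
      using degree_deviation_ge_2[OF r]
      by (auto simp: AE_measure_pmf_iff indicator_def sum_nonneg)
  qed
  \<comment> \<open>Since each mean is 2, the expected squared deviation from 2 is the
    variance.\<close>
  also have "\<dots> = 1 / 2 * (\<Sum>i\<in>{1..n} - {r}. measure_pmf.variance q (\<lambda>U. real (vertex_degree i U)))"
    by (simp add: mean int Bochner_Integration.integral_sum)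
  finally show ?thesis .
qed

section \<open>Derivatives of the dual objective\<close>

text \<open>The lift is adjoint to the degree map, by exchanging the sums over edges and vertices.
  Hence the Gibbs exponent depends on \<open>lam\<close> only through the degree vector.\<close>

lemma edge_inner_lift_potential:
  assumes "U \<subseteq> complete_edges {1..n}"
  shows "edge_inner n (lift_potential \<nu> lam) (incidence U) = lam \<bullet> degree_vector \<nu> U"
proof -
  let ?E = "complete_edges {1..n}"
  have fin: "finite ?E" by (simp add: finite_complete_edges)
  have "edge_inner n (lift_potential \<nu> lam) (incidence U)
      = (\<Sum>e\<in>?E. \<Sum>k\<in>UNIV. if \<nu> k \<in> e \<and> e \<in> U then lam $ k else 0)"
    unfolding edge_inner_def lift_potential_def incidence_def
    by (intro sum.cong refl) (auto simp: sum.If_cases)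
  also have "\<dots> = (\<Sum>k\<in>UNIV. \<Sum>e\<in>?E. if \<nu> k \<in> e \<and> e \<in> U then lam $ k else 0)"
    by (rule sum.swap)
  also have "\<dots> = (\<Sum>k\<in>UNIV. lam $ k * real (vertex_degree (\<nu> k) U))"
  proof (intro sum.cong refl)
    fix k
    have "?E \<inter> {e. \<nu> k \<in> e \<and> e \<in> U} = {e \<in> U. \<nu> k \<in> e}" using assms by auto
    then show "(\<Sum>e\<in>?E. if \<nu> k \<in> e \<and> e \<in> U then lam $ k else 0)
        = lam $ k * real (vertex_degree (\<nu> k) U)"
      using fin by (simp add: sum.If_cases vertex_degree_def)
  qed
  finally show ?thesis by (simp add: inner_vec_def degree_vector_def)
qed

text \<open>The unnormalised Gibbs weight at the shifted cost, written so that its dependence on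
  \<open>lam\<close> is visibly the exponential of an affine function.\<close>

definition gibbs_weight ::
    "nat \<Rightarrow> ('k::finite \<Rightarrow> nat) \<Rightarrow> real \<Rightarrow> (nat set \<Rightarrow> real) \<Rightarrow> nat set set \<Rightarrow> real ^ 'k \<Rightarrow> real" where
  "gibbs_weight n \<nu> \<tau> c U lam =
     exp (- (1 / \<tau>) * (edge_inner n c (incidence U) + lam \<bullet> degree_vector \<nu> U))"

lemma exp_shifted_cost:
  assumes "U \<in> one_trees n r"
  shows "exp (- (1 / \<tau>) * edge_inner n (shifted_cost \<nu> c lam) (incidence U)) = gibbs_weight n \<nu> \<tau> c U lam"
proof -
  have "U \<subseteq> complete_edges {1..n}"
    using assms by (rule one_trees_subset_complete_edges)
  then have "edge_inner n (shifted_cost \<nu> c lam) (incidence U)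
      = edge_inner n c (incidence U) + lam \<bullet> degree_vector \<nu> U"
    using edge_inner_lift_potential[of U n \<nu> lam]
    by (simp add: edge_inner_def shifted_cost_def distrib_right sum.distrib)
  then show ?thesis by (simp add: gibbs_weight_def)
qed

lemma partition_fun_shifted_cost:
  "partition_fun n r \<tau> (shifted_cost \<nu> c lam) = (\<Sum>U\<in>one_trees n r. gibbs_weight n \<nu> \<tau> c U lam)"
  unfolding partition_fun_def by (intro sum.cong refl exp_shifted_cost)

lemma has_derivative_gibbs_weight [derivative_intros]:
  fixes \<nu> :: "'k::finite \<Rightarrow> nat"
  shows "(gibbs_weight n \<nu> \<tau> c U has_derivative
     (\<lambda>h. - (1 / \<tau>) * (h \<bullet> degree_vector \<nu> U) * gibbs_weight n \<nu> \<tau> c U lam)) (at lam within S)"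
proof -
  have "((\<lambda>lam. exp (s * (a + lam \<bullet> D))) has_derivative
      (\<lambda>h. s * (h \<bullet> D) * exp (s * (a + lam \<bullet> D)))) (at lam within S)" for s a :: real and D :: "real ^ 'k"
    by (auto intro!: derivative_eq_intros simp: mult_ac)
  then show ?thesis unfolding gibbs_weight_def[abs_def] .
qed

text \<open>For fixed \<open>c\<close> the laws \<open>Q lam\<close> form an exponential family with
  sufficient statistic \<open>d\<close>, natural parameter \<open>- lam / \<tau>\<close> and
  normaliser \<open>Z\<close>.\<close>

locale gibbs_family =
  fixes n r :: nat and \<nu> :: "'k::finite \<Rightarrow> nat" and \<tau> :: real and c :: "nat set \<Rightarrow> real"
  assumes n: "3 \<le> n" and r: "r \<in> {1..n}" and \<tau>: "0 < \<tau>"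
begin

abbreviation "Z lam \<equiv> \<Sum>U\<in>one_trees n r. gibbs_weight n \<nu> \<tau> c U lam"
abbreviation "Q lam \<equiv> gibbs n r \<tau> (shifted_cost \<nu> c lam)"
abbreviation "d \<equiv> degree_vector \<nu>"

lemma Z_pos: "0 < Z lam"
  by (intro sum_pos) (simp_all add: finite_one_trees one_trees_nonempty[OF n r] gibbs_weight_def)

lemma pmf_Q: "pmf (Q lam) U = (if U \<in> one_trees n r then gibbs_weight n \<nu> \<tau> c U lam / Z lam else 0)"
  using exp_shifted_cost[of U n r \<tau> \<nu> c lam]
  by (simp add: pmf_gibbs[OF n r] partition_fun_shifted_cost)

lemma set_pmf_Q: "set_pmf (Q lam) \<subseteq> one_trees n r"
  by (auto simp: set_pmf_eq pmf_Q)

lemma expectation_Q: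
  fixes f :: "nat set set \<Rightarrow> 'b::{banach, second_countable_topology}"
  shows "measure_pmf.expectation (Q lam) f
    = (\<Sum>U\<in>one_trees n r. (gibbs_weight n \<nu> \<tau> c U lam / Z lam) *\<^sub>R f U)"
  using set_pmf_Q by (subst integral_measure_pmf[OF finite_one_trees[of n r]]) (auto simp: pmf_Q)

text \<open>Turns the weighted sums produced by differentiation into moments of
  \<open>Q lam\<close>.\<close>

lemma sum_gibbs_weight_scaleR:
  fixes f :: "nat set set \<Rightarrow> 'b::{banach, second_countable_topology}"
  shows "(\<Sum>U\<in>one_trees n r. gibbs_weight n \<nu> \<tau> c U lam *\<^sub>R f U)
    = Z lam *\<^sub>R measure_pmf.expectation (Q lam) f"
  using Z_pos[of lam] by (simp add: expectation_Q scaleR_sum_right)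

lemma integrable_Q:
  fixes f :: "nat set set \<Rightarrow> 'b::{banach, second_countable_topology}"
  shows "integrable (Q lam) f"
  by (rule integrable_measure_pmf_finite[OF finite_subset[OF set_pmf_Q finite_one_trees]])

lemma expectation_Q_nth:
  fixes f :: "nat set set \<Rightarrow> real ^ 'm"
  shows "measure_pmf.expectation (Q lam) f $ k = measure_pmf.expectation (Q lam) (\<lambda>U. f U $ k)"
proof -
  have "measure_pmf.expectation (Q lam) (\<lambda>U. f U \<bullet> axis k 1) = measure_pmf.expectation (Q lam) f \<bullet> axis k 1"
    by (rule integral_inner_left[OF integrable_Q])
  then show ?thesis by (simp add: inner_axis)
qed

lemma has_derivative_Z:
  "(Z has_derivative (\<lambda>h. - (1 / \<tau>) * Z lam * (h \<bullet> measure_pmf.expectation (Q lam) d))) (at lam)"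
proof -
  have "(Z has_derivative (\<lambda>h. \<Sum>U\<in>one_trees n r.
      - (1 / \<tau>) * (h \<bullet> d U) * gibbs_weight n \<nu> \<tau> c U lam)) (at lam)"
    by (intro derivative_intros)
  also have "(\<lambda>h. \<Sum>U\<in>one_trees n r. - (1 / \<tau>) * (h \<bullet> d U) * gibbs_weight n \<nu> \<tau> c U lam)
      = (\<lambda>h. - (1 / \<tau>) * (h \<bullet> (\<Sum>U\<in>one_trees n r. gibbs_weight n \<nu> \<tau> c U lam *\<^sub>R d U)))"
    by (simp add: inner_sum_right sum_distrib_left mult_ac sum_negf sum_divide_distrib)
  finally show ?thesis by (simp add: sum_gibbs_weight_scaleR mult_ac)
qed

text \<open>The logarithmic derivative of \<open>Z\<close> is the mean degree scaled by
  \<open>- 1 / \<tau>\<close>, which the prefactor \<open>- \<tau>\<close> cancels.\<close>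

lemma gradient_dual_objective:
  "gradient (dual_objective n r \<nu> \<tau> c) lam = measure_pmf.expectation (Q lam) d - 2 *\<^sub>R 1"
proof -
  have "((\<lambda>lam. - \<tau> * ln (Z lam) - 2 * (1 \<bullet> lam)) has_derivative
      (\<lambda>h. h \<bullet> (measure_pmf.expectation (Q lam) d - 2 *\<^sub>R 1))) (at lam)"
  proof (rule has_derivative_eq_rhs)
    show "((\<lambda>lam. - \<tau> * ln (Z lam) - 2 * (1 \<bullet> lam)) has_derivative
        (\<lambda>h. - \<tau> * (- (1 / \<tau>) * Z lam * (h \<bullet> measure_pmf.expectation (Q lam) d) * inverse (Z lam))
          - 2 * (1 \<bullet> h))) (at lam)"
      by (intro has_derivative_diff has_derivative_mult_right has_derivative_ln has_derivative_Z Z_pos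
          has_derivative_inner_right has_derivative_ident)
    show "(\<lambda>h. - \<tau> * (- (1 / \<tau>) * Z lam * (h \<bullet> measure_pmf.expectation (Q lam) d) * inverse (Z lam))
          - 2 * (1 \<bullet> h)) = (\<lambda>h. h \<bullet> (measure_pmf.expectation (Q lam) d - 2 *\<^sub>R 1))"
      using Z_pos[of lam] \<tau> by (simp add: fun_eq_iff inner_diff_right inner_commute field_simps)
  qed
  then have D: "GDERIV (dual_objective n r \<nu> \<tau> c) lam :> measure_pmf.expectation (Q lam) d - 2 *\<^sub>R 1"
    by (simp add: gderiv_def dual_objective_def[abs_def] partition_fun_shifted_cost)
  \<comment> \<open>Evaluating the \<open>THE\<close> also needs uniqueness: a vector is determined
    by its inner products with all \<open>h\<close>.\<close>
  show ?thesis unfolding gradient_def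
  proof (rule the_equality, rule D)
    fix D' assume "GDERIV (dual_objective n r \<nu> \<tau> c) lam :> D'"
    from has_derivative_unique[OF this[unfolded gderiv_def] D[unfolded gderiv_def]]
    have "\<forall>h. h \<bullet> D' = h \<bullet> (measure_pmf.expectation (Q lam) d - 2 *\<^sub>R 1)"
      by (intro allI) (rule fun_cong)
    then show "D' = measure_pmf.expectation (Q lam) d - 2 *\<^sub>R 1"
      by (simp only: vector_eq_ldot)
  qed
qed

text \<open>Quotient rule for the weighted degree sum over \<open>Z\<close>. Differentiating
  \<open>inverse (Z lam)\<close> yields the product of means, so the bracket is the covariance
  matrix applied to \<open>h\<close>.\<close>

lemma has_derivative_mean_degree:
  "((\<lambda>lam. measure_pmf.expectation (Q lam) d) has_derivative
     (\<lambda>h. - (1 / \<tau>) *\<^sub>R (measure_pmf.expectation (Q lam) (\<lambda>U. (h \<bullet> d U) *\<^sub>R d U)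
        - (h \<bullet> measure_pmf.expectation (Q lam) d) *\<^sub>R measure_pmf.expectation (Q lam) d))) (at lam)"
proof -
  let ?N = "\<lambda>lam. \<Sum>U\<in>one_trees n r. gibbs_weight n \<nu> \<tau> c U lam *\<^sub>R d U"
  let ?E = "measure_pmf.expectation (Q lam) d"
  have "(?N has_derivative (\<lambda>h. \<Sum>U\<in>one_trees n r.
      (- (1 / \<tau>) * (h \<bullet> d U) * gibbs_weight n \<nu> \<tau> c U lam) *\<^sub>R d U)) (at lam)"
    by (intro derivative_intros)
  also have "(\<lambda>h. \<Sum>U\<in>one_trees n r. (- (1 / \<tau>) * (h \<bullet> d U) * gibbs_weight n \<nu> \<tau> c U lam) *\<^sub>R d U)
      = (\<lambda>h. - (1 / \<tau>) *\<^sub>R (\<Sum>U\<in>one_trees n r. gibbs_weight n \<nu> \<tau> c U lam *\<^sub>R ((h \<bullet> d U) *\<^sub>R d U)))"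
    by (simp add: scaleR_sum_right mult_ac sum_negf)
  finally have N: "(?N has_derivative (\<lambda>h. - (1 / \<tau>) *\<^sub>R (Z lam *\<^sub>R
      measure_pmf.expectation (Q lam) (\<lambda>U. (h \<bullet> d U) *\<^sub>R d U)))) (at lam)"
    by (simp only: sum_gibbs_weight_scaleR)
  have deriv: "((\<lambda>lam. inverse (Z lam) *\<^sub>R ?N lam) has_derivative
     (\<lambda>h. inverse (Z lam) *\<^sub>R (- (1 / \<tau>) *\<^sub>R (Z lam *\<^sub>R
        measure_pmf.expectation (Q lam) (\<lambda>U. (h \<bullet> d U) *\<^sub>R d U)))
       + (- (inverse (Z lam) * (- (1 / \<tau>) * Z lam * (h \<bullet> ?E)) * inverse (Z lam))) *\<^sub>R ?N lam)) (at lam)"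
    by (rule has_derivative_scaleR[OF Deriv.has_derivative_inverse[OF _ has_derivative_Z] N])
       (use Z_pos[of lam] in linarith)
  have mean: "(\<lambda>lam. inverse (Z lam) *\<^sub>R ?N lam) = (\<lambda>lam. measure_pmf.expectation (Q lam) d)"
    by (simp add: fun_eq_iff expectation_Q scaleR_sum_right divide_inverse mult.commute)
  \<comment> \<open>Cancellation of the normaliser, stated for generic terms and applied with
    \<open>z\<close> as \<open>Z lam\<close>.\<close>
  have rhs: "inverse z *\<^sub>R (- (1 / \<tau>) *\<^sub>R (z *\<^sub>R X)) + (- (inverse z * (- (1 / \<tau>) * z * y) * inverse z)) *\<^sub>R (z *\<^sub>R E)
      = - (1 / \<tau>) *\<^sub>R (X - y *\<^sub>R E)" if "z \<noteq> 0" for z y and X E :: "real ^ 'k"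
    using that by (simp add: algebra_simps)
  have "Z lam \<noteq> 0" using Z_pos[of lam] by linarith
  then show ?thesis using deriv[unfolded mean, unfolded sum_gibbs_weight_scaleR] by (simp only: rhs not_False_eq_True)
qed

text \<open>The diagonal entries agree one by one: entry \<open>k\<close> is the derivative of the
  \<open>k\<close>-th mean degree along axis \<open>k\<close>, which is minus the variance over
  \<open>\<tau>\<close>.\<close>

lemma trace_hessian_dual_objective:
  "trace (hessian (dual_objective n r \<nu> \<tau> c) lam) = - (1 / \<tau>) * trace (covariance_matrix (Q lam) d)"
proof -
  let ?E = "measure_pmf.expectation (Q lam)"
  have "(gradient (dual_objective n r \<nu> \<tau> c) has_derivative
     (\<lambda>h. - (1 / \<tau>) *\<^sub>R (?E (\<lambda>U. (h \<bullet> d U) *\<^sub>R d U) - (h \<bullet> ?E d) *\<^sub>R ?E d))) (at lam)"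
    unfolding gradient_dual_objective[abs_def]
    using has_derivative_diff[OF has_derivative_mean_degree has_derivative_const] by simp
  note H = frechet_derivative_at[OF this, symmetric]
  have "covariance (Q lam) (\<lambda>U. d U $ k) (\<lambda>U. d U $ k) = ?E (\<lambda>U. (d U $ k)\<^sup>2) - (?E d $ k)\<^sup>2" for k
    using measure_pmf.variance_eq[OF integrable_Q integrable_Q, of lam "\<lambda>U. d U $ k"]
    by (simp add: covariance_def power2_eq_square expectation_Q_nth)
  moreover have "hessian (dual_objective n r \<nu> \<tau> c) lam $ k $ k
      = - (1 / \<tau>) * (?E (\<lambda>U. (d U $ k)\<^sup>2) - (?E d $ k)\<^sup>2)" for k
    by (simp add: hessian_def matrix_def H expectation_Q_nth inner_axis' power2_eq_square)
  ultimately show ?thesis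
    by (simp add: trace_def covariance_matrix_def sum_distrib_left)
qed

end

section \<open>The non-tour bound\<close>

theorem theorem2p3:
  fixes n r :: nat and \<tau> :: real and \<nu> :: "'k::finite \<Rightarrow> nat"
  assumes "3 \<le> n" and "r \<in> {1..n}" and "0 < \<tau>" and "indexes_nonroot n r \<nu>"
  shows "(\<forall>q \<in> one_tree_dists n r.
            (\<forall>i\<in>{1..n} - {r}. measure_pmf.expectation q (\<lambda>U. real (vertex_degree i U)) = 2) \<longrightarrow>
            non_tour_mass n r q
              \<le> 1 / 2 * (\<Sum>i\<in>{1..n} - {r}. measure_pmf.variance q (\<lambda>U. real (vertex_degree i U))))
       \<and> (\<forall>(c :: nat set \<Rightarrow> real) (lam :: real ^ 'k).
            gradient (dual_objective n r \<nu> \<tau> c) lam = 0 \<longrightarrow>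
            (let q = gibbs n r \<tau> (shifted_cost \<nu> c lam);
                 V = (\<Sum>i\<in>{1..n} - {r}. measure_pmf.variance q (\<lambda>U. real (vertex_degree i U)))
             in non_tour_mass n r q \<le> 1 / 2 * V
              \<and> 1 / 2 * V = 1 / 2 * trace (covariance_matrix q (degree_vector \<nu>))
              \<and> 1 / 2 * trace (covariance_matrix q (degree_vector \<nu>))
                  = - (\<tau> / 2) * trace (hessian (dual_objective n r \<nu> \<tau> c) lam)))"
proof (intro conjI ballI allI impI)
  fix q assume "q \<in> one_tree_dists n r"
    and "\<forall>i\<in>{1..n} - {r}. measure_pmf.expectation q (\<lambda>U. real (vertex_degree i U)) = 2"
  then show "non_tour_mass n r q
      \<le> 1 / 2 * (\<Sum>i\<in>{1..n} - {r}. measure_pmf.variance q (\<lambda>U. real (vertex_degree i U)))"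
    using non_tour_mass_le[OF assms(2)] by blast
next
  fix c :: "nat set \<Rightarrow> real" and lam :: "real ^ 'k"
  assume grad: "gradient (dual_objective n r \<nu> \<tau> c) lam = 0"
  interpret gibbs_family n r \<nu> \<tau> c using assms(1-3) by unfold_locales
  let ?V = "\<Sum>i\<in>{1..n} - {r}. measure_pmf.variance (Q lam) (\<lambda>U. real (vertex_degree i U))"
  have \<nu>: "bij_betw \<nu> UNIV ({1..n} - {r})" using assms(4) by (simp add: indexes_nonroot_def)
  \<comment> \<open>Read coordinatewise, the vanishing gradient is degree balance.\<close>
  have "measure_pmf.expectation (Q lam) (\<lambda>U. real (vertex_degree (\<nu> k) U)) = 2" for k
  proof -
    have "measure_pmf.expectation (Q lam) d $ k = 2"
      using grad by (simp add: gradient_dual_objective)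
    then show ?thesis by (simp add: expectation_Q_nth degree_vector_def)
  qed
  then have "measure_pmf.expectation (Q lam) (\<lambda>U. real (vertex_degree i U)) = 2"
    if "i \<in> {1..n} - {r}" for i
    using that \<nu> by (metis bij_betw_imp_surj_on imageE)
  moreover have "Q lam \<in> one_tree_dists n r" using set_pmf_Q by (simp add: one_tree_dists_def)
  ultimately have "non_tour_mass n r (Q lam) \<le> 1 / 2 * ?V"
    using non_tour_mass_le[OF assms(2)] by blast
  \<comment> \<open>The bijection \<open>\<nu>\<close> carries the trace over the index type to the
    sum over non-root vertices.\<close>
  moreover have "?V = trace (covariance_matrix (Q lam) d)"
    using sum.reindex_bij_betw[OF \<nu>, of "\<lambda>i. measure_pmf.variance (Q lam) (\<lambda>U. real (vertex_degree i U))"]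
    by (simp add: trace_def covariance_matrix_def covariance_def degree_vector_def power2_eq_square)
  moreover have "1 / 2 * trace (covariance_matrix (Q lam) d)
      = - (\<tau> / 2) * trace (hessian (dual_objective n r \<nu> \<tau> c) lam)"
    using assms(3) by (simp add: trace_hessian_dual_objective)
  ultimately show "let q = Q lam;
        V = (\<Sum>i\<in>{1..n} - {r}. measure_pmf.variance q (\<lambda>U. real (vertex_degree i U)))
      in non_tour_mass n r q \<le> 1 / 2 * V
       \<and> 1 / 2 * V = 1 / 2 * trace (covariance_matrix q d)
       \<and> 1 / 2 * trace (covariance_matrix q d)
           = - (\<tau> / 2) * trace (hessian (dual_objective n r \<nu> \<tau> c) lam)"
    by (simp add: Let_def)
qed

end
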